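(* Let $q$ be a complex number with $|q|<1$. Then the following three identities hold: \begin{align*} \sum_{i,j\geq 0}\frac{q^{i^2+2ij+2j^2}}{(q;q)_i(q^2;q^2)_j}&=\frac{(q^3;q^3)_\infty^2}{(q;q)_\infty(q^6;q^6)_\infty}, \\ \sum_{i,j\geq 0}\frac{q^{i^2+2ij+2j^2+i+2j}}{(q;q)_i(q^2;q^2)_j}&=\frac{(q^6;q^6)_\infty^2}{(q^2;q^2)_\infty (q^3;q^3)_\infty}, \\ \sum_{i,j\geq 0}\frac{q^{i^2+2ij+2j^2+j}}{(q;q)_i(q^2;q^2)_j}&=(-q;q)_\infty, \end{align*} where the sums run over all pairs of nonnegative integers $(i,j)$.
   Context: Notation ($q$-Pochhammer symbols): for complex $a$ and a base $p$ with $|p|<1$, $(a;p)_0:=1$, $(a;p)_n:=\prod_{k=0}^{n-1}(1-ap^k)$ for integers $n\ge 1$, and $(a;p)_\infty:=\prod_{k=0}^{\infty}(1-ap^k)$. *)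

theory Defs
  imports "HOL-Analysis.Analysis"
begin

definition qpoch :: "complex \<Rightarrow> complex \<Rightarrow> nat \<Rightarrow> complex" where
  "qpoch a p n = (\<Prod>k<n. 1 - a * p ^ k)"

definition qpoch_inf :: "complex \<Rightarrow> complex \<Rightarrow> complex" where
  "qpoch_inf a p = (\<Prod>k. 1 - a * p ^ k)"

text \<open>
  For \<open>norm p < 1\<close> the infinite product converges, so the value of
  \<^const>\<open>qpoch_inf\<close> is the genuine one; vanishing factors are allowed.
\<close>

lemma convergent_prod_qpoch_inf:
  fixes a p :: complex
  assumes "norm p < 1"
  shows "convergent_prod (\<lambda>k. 1 - a * p ^ k)"
proof -
  have "summable (\<lambda>k. norm a * norm p ^ k)"
    using assms by (intro summable_mult summable_geometric) auto
  then have "summable (\<lambda>k. norm ((1 - a * p ^ k) - 1))"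
    by (simp add: norm_mult norm_power del: summable_cmult_iff)
  then show ?thesis
    by (intro abs_convergent_prod_imp_convergent_prod summable_imp_abs_convergent_prod)
qed

end

theory Submission
  imports Defs
begin

text \<open>
  With \<open>n = i + j\<close> the exponent \<open>i\<^sup>2 + 2ij + 2j\<^sup>2\<close> becomes \<open>n\<^sup>2 + j\<^sup>2\<close>, so each double sum is
  \<open>\<Sum>\<^sub>n w\<^sub>n \<Sum>\<^sub>j w\<^sub>j \<beta>\<^sub>j / (q;q)\<^sub>n\<^sub>-\<^sub>j\<close> with \<open>w\<^sub>n = q\<^bsup>n^2 + an\<^esup>\<close> and \<open>\<beta>\<^sub>j = q\<^bsup>cj\<^esup> / (q\<^sup>2;q\<^sup>2)\<^sub>j\<close>,
  where \<open>(a, c)\<close> is \<open>(0, 0)\<close>, \<open>(1, 0)\<close> and \<open>(0, 1)\<close> in the three identities. This is the shape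
  produced by two applications of Bailey's lemma followed by a passage to the limit.

  A sequence \<open>\<alpha>\<close> indexed by the integers and a sequence \<open>\<beta>\<close> form a Bailey pair with shift \<open>a\<close> if
  \<open>\<beta>\<^sub>n = \<Sum>\<^sub>r \<alpha>\<^sub>r / ((q;q)\<^sub>n\<^sub>-\<^sub>r (q;q)\<^sub>n\<^sub>+\<^sub>a\<^sub>+\<^sub>r)\<close>. Bailey's lemma (\<open>bailey_lemma\<close>), which is the
  q-Chu-Vandermonde summation \<open>q_vandermonde\<close> after exchanging two finite sums, says that
  \<open>w\<^sub>r \<alpha>\<^sub>r\<close> and \<open>\<Sum>\<^sub>j w\<^sub>j \<beta>\<^sub>j / (q;q)\<^sub>n\<^sub>-\<^sub>j\<close> again form such a pair. Two applications and the limit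
  \<open>n \<longlonglongrightarrow> \<infinity>\<close>, justified by dominated convergence, turn the double sum into
  \<open>\<Sum>\<^sub>r w\<^sub>r\<^sup>2 \<alpha>\<^sub>r / (q;q)\<^sub>\<infinity>\<close> (\<open>bailey_double_sum\<close>).

  The three \<open>\<beta>\<close> that occur belong to theta sequences \<open>\<alpha>\<^sub>r = (-1)\<^sup>r q\<^bsup>r^2\<^esup> z\<^sup>r\<close> with \<open>z = 1\<close> or \<open>z = q\<close>
  (\<open>theta_pair_even\<close>, \<open>theta_pair_odd\<close>, \<open>theta_pair_linear\<close>). Hence each double sum equals
  \<open>\<Sum>\<^sub>r (-1)\<^sup>r q\<^bsup>3r^2 + kr\<^esup> / (q;q)\<^sub>\<infinity>\<close> with \<open>k = 0, 2, 1\<close> respectively. Jacobi's triple product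
  (\<open>jacobi_triple_product\<close>) evaluates the numerator as
  \<open>(q\<^sup>6;q\<^sup>6)\<^sub>\<infinity> (q\<^bsup>3+k\<^esup>;q\<^sup>6)\<^sub>\<infinity> (q\<^bsup>3-k\<^esup>;q\<^sup>6)\<^sub>\<infinity>\<close>, and the stated products follow on sorting the factors
  by their exponents modulo 6.

  All finite evaluations (Vandermonde, the theta pairs, the finite triple product) concern
  \<open>\<Sum>\<^sub>r \<alpha>\<^sub>r / ((q;q)\<^sub>u\<^sub>-\<^sub>r (q;q)\<^sub>v\<^sub>+\<^sub>r)\<close> and are consequences of two recurrences, one lowering \<open>u\<close> and one
  lowering \<open>v\<close>. Integer exponents force \<open>q \<noteq> 0\<close>; for \<open>q = 0\<close> only the term \<open>i = j = 0\<close> survives.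
\<close>

section \<open>Infinite sums\<close>

lemma infsum_shift_int: "(\<Sum>\<^sub>\<infinity>r::int. f (r + c)) = (\<Sum>\<^sub>\<infinity>r. f r)"
  by (rule infsum_reindex_bij_witness[of _ "\<lambda>r. r - c" "\<lambda>r. r + c"]) auto

lemma infsum_reflect_int: "(\<Sum>\<^sub>\<infinity>r::int. f (c - r)) = (\<Sum>\<^sub>\<infinity>r. f r)"
  by (rule infsum_reindex_bij_witness[of _ "\<lambda>r. c - r" "\<lambda>r. c - r"]) auto

text \<open>
  Tannery's theorem: the domination makes the partial sums converge uniformly in \<open>N\<close>, so the limit
  over finite subsets and the limit over \<open>N\<close> can be exchanged.
\<close>

lemma tannery_infsum:
  fixes f :: "nat \<Rightarrow> 'a \<Rightarrow> complex"
  assumes bound: "\<And>N x. norm (f N x) \<le> h x"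
    and h: "h summable_on UNIV"
    and lim: "\<And>x. (\<lambda>N. f N x) \<longlonglongrightarrow> g x"
  shows "(\<lambda>N. infsum (f N) UNIV) \<longlonglongrightarrow> infsum g UNIV"
proof -
  have unif: "uniform_limit UNIV (\<lambda>X N. \<Sum>x\<in>X. f N x) (\<lambda>N. infsum (f N) UNIV)
      (finite_subsets_at_top UNIV)"
    using Weierstrass_m_test_general[of UNIV UNIV "\<lambda>x N. f N x" h] bound h by auto
  have norm_g: "norm (g x) \<le> h x" for x
    by (rule LIMSEQ_le_const2[OF tendsto_norm[OF lim]]) (use bound in auto)
  have "g summable_on UNIV"
    by (rule abs_summable_summable, rule summable_on_comparison_test[OF h]) (auto simp: norm_g)
  then have g: "(sum g \<longlongrightarrow> infsum g UNIV) (finite_subsets_at_top UNIV)"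
    by (simp add: infsum_tendsto)
  show ?thesis
    by (rule swap_uniform_limit'[OF _ g unif])
      (auto intro!: always_eventually tendsto_sum lim)
qed

lemma summable_on_int_nat_split:
  fixes f :: "int \<Rightarrow> real"
  assumes "(\<lambda>n. f (int n)) summable_on UNIV" "(\<lambda>n. f (- int n)) summable_on UNIV"
  shows "f summable_on UNIV"
proof -
  have U: "(UNIV :: int set) = range int \<union> range (\<lambda>n. - int n)"
  proof -
    have "x \<in> range int \<union> range (\<lambda>n. - int n)" for x
      by (cases x rule: int_cases2) auto
    then show ?thesis by blast
  qed
  have "f summable_on range int" "f summable_on range (\<lambda>n. - int n)"
    using assms by (subst summable_on_reindex; simp add: inj_on_def o_def)+
  then show ?thesis
    unfolding U by (rule summable_on_union)
qed

lemma has_sum_via_injection: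
  assumes "inj h" and "\<And>y. y \<notin> range h \<Longrightarrow> f y = 0"
  shows "(f has_sum S) UNIV \<longleftrightarrow> ((\<lambda>x. f (h x)) has_sum S) UNIV"
proof -
  have "((\<lambda>x. f (h x)) has_sum S) UNIV \<longleftrightarrow> (f has_sum S) (range h)"
    using has_sum_reindex[OF assms(1), of f S] by (simp add: o_def)
  also have "\<dots> \<longleftrightarrow> (f has_sum S) UNIV"
    by (rule has_sum_cong_neutral) (use assms(2) in auto)
  finally show ?thesis by simp
qed

section \<open>q-Pochhammer symbols\<close>

lemma qpoch_0 [simp]: "qpoch a p 0 = 1"
  by (simp add: qpoch_def)

lemma qpoch_Suc: "qpoch a p (Suc n) = qpoch a p n * (1 - a * p ^ n)"
  by (simp add: qpoch_def)

lemma qpoch_tendsto: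
  assumes "norm p < 1"
  shows "(\<lambda>n. qpoch a p n) \<longlonglongrightarrow> qpoch_inf a p"
proof -
  have "(\<lambda>n. \<Prod>k\<le>n. 1 - a * p ^ k) \<longlonglongrightarrow> qpoch_inf a p"
    unfolding qpoch_inf_def
    by (rule convergent_prod_LIMSEQ[OF convergent_prod_qpoch_inf[OF assms]])
  then have "(\<lambda>n. qpoch a p (Suc n)) \<longlonglongrightarrow> qpoch_inf a p"
    by (simp add: qpoch_def lessThan_Suc_atMost)
  then show ?thesis
    by (rule LIMSEQ_imp_Suc)
qed

lemma one_minus_power_nonzero:
  fixes q :: complex
  assumes "norm q < 1" "0 < n"
  shows "1 - q ^ n \<noteq> 0"
proof
  assume "1 - q ^ n = 0"
  then have "norm q ^ n = 1"
    by (metis norm_one norm_power right_minus_eq)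
  moreover have "norm q ^ n < 1"
    using assms by (simp add: power_less_one_iff)
  ultimately show False by simp
qed

lemma qpoch_nonzero:
  assumes "norm q < 1"
  shows "qpoch q q n \<noteq> 0"
  using one_minus_power_nonzero[OF assms, of "Suc _"] by (auto simp: qpoch_def)

lemma qpoch_inf_nonzero:
  assumes "norm q < 1"
  shows "qpoch_inf q q \<noteq> 0"
  unfolding qpoch_inf_def
  by (rule prodinf_nonzero[OF convergent_prod_qpoch_inf[OF assms]])
    (use one_minus_power_nonzero[OF assms, of "Suc _"] in auto)

lemma prod_lessThan_add:
  fixes f :: "nat \<Rightarrow> 'a :: comm_monoid_mult"
  shows "(\<Prod>k<M + m. f k) = (\<Prod>k<M. f k) * (\<Prod>k<m. f (M + k))"
  by (induction m) (simp_all add: mult_ac)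

text \<open>
  The factors with exponent congruent to \<open>k\<close> modulo \<open>m\<close> form a Pochhammer symbol to the base \<open>p ^ m\<close>.
\<close>

lemma qpoch_dissect:
  "qpoch a p (m * n) = (\<Prod>k<m. qpoch (a * p ^ k) (p ^ m) n)"
proof (induction n)
  case (Suc n)
  have "qpoch a p (m * Suc n) = qpoch a p (m * n) * (\<Prod>k<m. 1 - a * p ^ (m * n + k))"
    unfolding qpoch_def by (simp only: mult_Suc_right add.commute[of m] prod_lessThan_add)
  also have "\<dots> = (\<Prod>k<m. qpoch (a * p ^ k) (p ^ m) n * (1 - a * p ^ (m * n + k)))"
    using Suc by (simp add: prod.distrib)
  also have "\<dots> = (\<Prod>k<m. qpoch (a * p ^ k) (p ^ m) (Suc n))"
    by (intro prod.cong) (simp_all add: qpoch_Suc power_add power_mult mult_ac)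
  finally show ?case .
qed simp

lemma qpoch_inf_dissect:
  assumes "norm p < 1" "0 < m"
  shows "qpoch_inf a p = (\<Prod>k<m. qpoch_inf (a * p ^ k) (p ^ m))"
proof -
  have pm: "norm (p ^ m) < 1"
    using assms by (simp add: norm_power power_less_one_iff)
  have "(\<lambda>n. qpoch a p (m * n)) \<longlonglongrightarrow> qpoch_inf a p"
    using LIMSEQ_subseq_LIMSEQ[OF qpoch_tendsto[OF assms(1)], of "\<lambda>n. m * n" a] assms(2)
    by (simp add: o_def strict_mono_def)
  moreover have "(\<lambda>n. qpoch a p (m * n)) \<longlonglongrightarrow> (\<Prod>k<m. qpoch_inf (a * p ^ k) (p ^ m))"
    unfolding qpoch_dissect by (intro tendsto_prod qpoch_tendsto pm)
  ultimately show ?thesis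
    by (rule LIMSEQ_unique)
qed

text \<open>
  Factorwise, \<open>1 - q\<^bsup>2k\<^esup> = (1 - q\<^sup>k) (1 + q\<^sup>k)\<close>.
\<close>

lemma qpoch_inf_square:
  assumes "norm q < 1"
  shows "qpoch_inf (q\<^sup>2) (q\<^sup>2) = qpoch_inf q q * qpoch_inf (- q) q"
proof -
  have q2: "norm (q\<^sup>2) < 1"
    using assms by (simp add: norm_power power_less_one_iff)
  have "qpoch (q\<^sup>2) (q\<^sup>2) n = qpoch q q n * qpoch (- q) q n" for n
    unfolding qpoch_def prod.distrib[symmetric]
    by (intro prod.cong) (auto simp: algebra_simps power2_eq_square power_mult_distrib)
  then have "(\<lambda>n. qpoch (q\<^sup>2) (q\<^sup>2) n) \<longlonglongrightarrow> qpoch_inf q q * qpoch_inf (- q) q"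
    by (auto intro!: tendsto_mult qpoch_tendsto assms)
  with qpoch_tendsto[OF q2] show ?thesis
    by (rule LIMSEQ_unique)
qed

section \<open>Reciprocals of q-factorials with integer index\<close>

text \<open>
  The value \<open>0\<close> at negative indices is the usual convention \<open>1 / (q;q)\<^sub>n = 0\<close>. It cuts off all
  summation ranges automatically, and it makes the recurrence \<open>inv_qfac_pred\<close> hold at every integer:
  at \<open>n = 0\<close> the factor \<open>1 - q powi n\<close> vanishes.
\<close>

definition inv_qfac :: "complex \<Rightarrow> int \<Rightarrow> complex" where
  "inv_qfac q n = (if n < 0 then 0 else inverse (qpoch q q (nat n)))"

lemma inv_qfac_neg [simp]: "n < 0 \<Longrightarrow> inv_qfac q n = 0"
  by (simp add: inv_qfac_def)

lemma inv_qfac_nonzeroD: "inv_qfac q n \<noteq> 0 \<Longrightarrow> 0 \<le> n"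
  by (cases "n < 0") auto

lemma inv_qfac_of_nat: "inv_qfac q (int n) = inverse (qpoch q q n)"
  by (simp add: inv_qfac_def)

lemma inv_qfac_0 [simp]: "inv_qfac q 0 = 1"
  by (simp add: inv_qfac_def)

lemma inv_qfac_pred:
  assumes "norm q < 1"
  shows "inv_qfac q (n - 1) = (1 - q powi n) * inv_qfac q n"
proof (cases "0 < n")
  case True
  define m where "m = nat (n - 1)"
  have n: "n = int (Suc m)" and n': "n - 1 = int m" "int (Suc m) - 1 = int m"
    using True by (auto simp: m_def)
  have "1 - q ^ Suc m \<noteq> 0"
    by (rule one_minus_power_nonzero[OF assms]) simp
  moreover have "q powi n = q ^ Suc m"
    unfolding n by (rule power_int_of_nat)
  ultimately show ?thesis
    unfolding n' unfolding n inv_qfac_of_nat power_int_of_nat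
    by (simp add: qpoch_Suc)
next
  case False
  then show ?thesis by (cases "n = 0") auto
qed

lemma inv_qfac_bounded:
  assumes "norm q < 1"
  obtains C where "0 < C" "\<And>n. norm (inv_qfac q n) \<le> C"
proof -
  have "convergent (\<lambda>n. inverse (qpoch q q n))"
    using tendsto_inverse[OF qpoch_tendsto[OF assms] qpoch_inf_nonzero[OF assms]]
    by (auto simp: convergent_def)
  then obtain C where C: "0 < C" "\<And>n. norm (inverse (qpoch q q n)) \<le> C"
    by (metis Bseq_def convergent_imp_Bseq)
  then have "norm (inv_qfac q n) \<le> C" for n
    by (auto simp: inv_qfac_def)
  with C(1) show ?thesis by (rule that)
qed

lemma inv_qfac_tendsto:
  assumes "norm q < 1"
  shows "(\<lambda>N. inv_qfac q (int N + c)) \<longlonglongrightarrow> inverse (qpoch_inf q q)"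
proof -
  have "(\<lambda>n. inv_qfac q (int n)) \<longlonglongrightarrow> inverse (qpoch_inf q q)"
    unfolding inv_qfac_of_nat
    by (intro tendsto_inverse qpoch_tendsto qpoch_inf_nonzero assms)
  moreover have "filterlim (\<lambda>N. nat (int N + c)) sequentially sequentially"
    unfolding filterlim_at_top
  proof
    fix Z
    show "\<forall>\<^sub>F N in sequentially. Z \<le> nat (int N + c)"
      using eventually_ge_at_top[of "Z + nat \<bar>c\<bar>"] by eventually_elim linarith
  qed
  ultimately have "(\<lambda>N. inv_qfac q (int (nat (int N + c)))) \<longlonglongrightarrow> inverse (qpoch_inf q q)"
    by (rule filterlim_compose)
  moreover have "\<forall>\<^sub>F N in sequentially. inv_qfac q (int (nat (int N + c))) = inv_qfac q (int N + c)"
    using eventually_ge_at_top[of "nat \<bar>c\<bar>"] by eventually_elim simp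
  ultimately show ?thesis
    by (rule Lim_transform_eventually)
qed

section \<open>Finite convolutions\<close>

text \<open>
  The sum is finite, since a nonzero term requires \<open>- v \<le> r \<le> u\<close>. A Bailey pair with shift \<open>a\<close> is the
  special case \<open>u = n\<close>, \<open>v = n + a\<close>; keeping \<open>u\<close> and \<open>v\<close> independent allows them to be lowered one at a
  time.
\<close>

definition qconv :: "complex \<Rightarrow> (int \<Rightarrow> complex) \<Rightarrow> int \<Rightarrow> int \<Rightarrow> complex" where
  "qconv q \<alpha> u v = (\<Sum>\<^sub>\<infinity>r. \<alpha> r * inv_qfac q (u - r) * inv_qfac q (v + r))"

lemma qconv_summable:
  "(\<lambda>r. \<alpha> r * inv_qfac q (u - r) * inv_qfac q (v + r)) summable_on UNIV"
proof (rule finite_nonzero_values_imp_summable_on, rule finite_subset)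
  show "{r \<in> UNIV. \<alpha> r * inv_qfac q (u - r) * inv_qfac q (v + r) \<noteq> 0} \<subseteq> {- v..u}"
    by (auto dest!: inv_qfac_nonzeroD)
qed simp

lemma qconv_cmult: "qconv q (\<lambda>r. c * \<alpha> r) u v = c * qconv q \<alpha> u v"
  unfolding qconv_def infsum_cmult_right'[symmetric] by (simp add: mult_ac)

lemma qconv_shift: "qconv q (\<lambda>r. \<alpha> (r + 1)) (u - 1) v = qconv q \<alpha> u (v - 1)"
  unfolding qconv_def
  by (subst infsum_shift_int[symmetric, where c = 1]) (simp add: algebra_simps)

lemma qconv_reflect: "qconv q (\<lambda>r. \<alpha> (c - r)) u v = qconv q \<alpha> (v + c) (u - c)"
  unfolding qconv_def
  by (subst (2) infsum_reflect_int[symmetric, where c = c]) (simp add: algebra_simps)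

lemma qconv_00 [simp]: "qconv q \<alpha> 0 0 = \<alpha> 0"
proof -
  have "qconv q \<alpha> 0 0 = (\<Sum>\<^sub>\<infinity>r\<in>{0}. \<alpha> r * inv_qfac q (0 - r) * inv_qfac q (0 + r))"
    unfolding qconv_def
    by (rule infsum_cong_neutral) (auto dest!: inv_qfac_nonzeroD)
  then show ?thesis by simp
qed

text \<open>
  Substituting \<open>1 - q powi (u - r)\<close> times \<open>inv_qfac q (u - r)\<close> for \<open>inv_qfac q (u - r - 1)\<close> leaves the
  weight \<open>q powi (- r)\<close> on \<open>\<alpha>\<close>; lowering \<open>v\<close> below produces the opposite weight \<open>q powi r\<close>.
\<close>

lemma qconv_pred_left:
  assumes "norm q < 1" "q \<noteq> 0"
  shows "qconv q \<alpha> (u - 1) v = qconv q \<alpha> u v - q powi u * qconv q (\<lambda>r. q powi (-r) * \<alpha> r) u v"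
proof -
  have "\<alpha> r * inv_qfac q (u - 1 - r) * inv_qfac q (v + r) =
      \<alpha> r * inv_qfac q (u - r) * inv_qfac q (v + r) +
      (- (q powi u)) * (q powi (-r) * \<alpha> r * inv_qfac q (u - r) * inv_qfac q (v + r))" for r
  proof -
    have "u - 1 - r = u - r - 1" by simp
    then show ?thesis
      using assms(2) by (simp only: inv_qfac_pred[OF assms(1)]) (simp add: power_int_diff power_int_minus divide_inverse algebra_simps)
  qed
  then show ?thesis
    unfolding qconv_def
    by (simp only: infsum_add[OF qconv_summable summable_on_cmult_right[OF qconv_summable]]
          infsum_cmult_right') simp
qed

lemma qconv_pred_right:
  assumes "norm q < 1" "q \<noteq> 0"
  shows "qconv q \<alpha> u (v - 1) = qconv q \<alpha> u v - q powi v * qconv q (\<lambda>r. q powi r * \<alpha> r) u v"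
proof -
  have "\<alpha> r * inv_qfac q (u - r) * inv_qfac q (v - 1 + r) =
      \<alpha> r * inv_qfac q (u - r) * inv_qfac q (v + r) +
      (- (q powi v)) * (q powi r * \<alpha> r * inv_qfac q (u - r) * inv_qfac q (v + r))" for r
  proof -
    have "v - 1 + r = v + r - 1" by simp
    then show ?thesis
      using assms(2) by (simp only: inv_qfac_pred[OF assms(1)]) (simp add: power_int_add algebra_simps)
  qed
  then show ?thesis
    unfolding qconv_def
    by (simp only: infsum_add[OF qconv_summable summable_on_cmult_right[OF qconv_summable]]
          infsum_cmult_right') simp
qed

section \<open>Bailey's lemma\<close>

text \<open>
  Write \<open>F m s\<close> for the left-hand side. Combining the two recurrences with a shift of the summation
  index gives \<open>(1 - q\<^sup>m) F m s = F (m - 1) s + q\<^bsup>m + s\<^esup> F (m - 1) (s + 1)\<close>. The right-hand side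
  satisfies the same recurrence, so induction on \<open>m\<close> over all \<open>s\<close> applies.
\<close>

lemma q_vandermonde_nat:
  assumes q: "norm q < 1" "q \<noteq> 0"
  shows "qconv q (\<lambda>k. q powi (k\<^sup>2 + k * s) * inv_qfac q (k + s)) (int m) 0
       = inv_qfac q (int m) * inv_qfac q (int m + s)"
proof (induction m arbitrary: s)
  case 0
  show ?case by simp
next
  case (Suc m)
  define \<beta> where "\<beta> = (\<lambda>s k. q powi (k\<^sup>2 + k * s) * inv_qfac q (k + s))"
  define u where "u = int (Suc m)"
  have u1: "u - 1 = int m" by (simp add: u_def)
  have IH: "qconv q (\<beta> s) (u - 1) 0 = inv_qfac q (u - 1) * inv_qfac q (u - 1 + s)" for s
    unfolding \<beta>_def u1 by (rule Suc.IH)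
  let ?\<gamma> = "\<lambda>k. q powi (-k) * \<beta> s k"
  have "?\<gamma> (k + 1) = q powi s * \<beta> (s + 1) k" for k
  proof -
    have e: "-(k+1) + ((k+1)\<^sup>2 + (k+1) * s) = s + (k\<^sup>2 + k * (s + 1))"
      by (simp add: power2_eq_square algebra_simps)
    have "q powi (-(k+1)) * q powi ((k+1)\<^sup>2 + (k+1) * s) = q powi s * q powi (k\<^sup>2 + k * (s + 1))"
      using q(2) by (simp only: power_int_add[symmetric] e simp_thms)
    then show ?thesis
      unfolding \<beta>_def by (simp only: mult.assoc[symmetric] add.assoc add.commute[of 1 s])
  qed
  then have "qconv q ?\<gamma> u (0 - 1) = q powi s * qconv q (\<beta> (s + 1)) (u - 1) 0"
    unfolding qconv_shift[symmetric] by (simp add: qconv_cmult)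
  moreover have "qconv q ?\<gamma> u (0 - 1) = qconv q ?\<gamma> u 0 - qconv q (\<beta> s) u 0"
  proof -
    have "q powi r * ?\<gamma> r = \<beta> s r" for r
      using q(2) by (simp add: power_int_minus)
    then show ?thesis
      using qconv_pred_right[OF q, of ?\<gamma> u 0] by (simp only: power_int_0_right mult_1_left)
  qed
  moreover have "qconv q (\<beta> s) (u - 1) 0 = qconv q (\<beta> s) u 0 - q powi u * qconv q ?\<gamma> u 0"
    by (rule qconv_pred_left[OF q])
  ultimately have "qconv q (\<beta> s) (u - 1) 0 = qconv q (\<beta> s) u 0
      - q powi u * (qconv q (\<beta> s) u 0 + q powi s * qconv q (\<beta> (s + 1)) (u - 1) 0)"
    by (metis diff_eq_eq add.commute)
  then have "(1 - q powi u) * qconv q (\<beta> s) u 0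
      = qconv q (\<beta> s) (u - 1) 0 + q powi (u + s) * qconv q (\<beta> (s + 1)) (u - 1) 0"
    using q(2) by (simp add: algebra_simps power_int_add)
  also have "\<dots> = inv_qfac q (u - 1) * inv_qfac q (u + s)"
  proof -
    have "u - 1 + s = u + s - 1" "u - 1 + (s + 1) = u + s" by simp_all
    then show ?thesis
      by (simp only: IH inv_qfac_pred[OF q(1), of "u + s"]) (simp add: algebra_simps)
  qed
  also have "\<dots> = (1 - q powi u) * (inv_qfac q u * inv_qfac q (u + s))"
    using inv_qfac_pred[OF q(1), of u] by simp
  finally have "qconv q (\<beta> s) u 0 = inv_qfac q u * inv_qfac q (u + s)"
    using one_minus_power_nonzero[OF q(1), of "Suc m"] 
    by (simp add: u_def power_int_of_nat del: of_nat_Suc)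
  then show ?case by (simp add: \<beta>_def u_def)
qed

text \<open>
  The substitution \<open>j = k + r\<close> reduces this to the preceding lemma with \<open>m = n - r\<close> and
  \<open>s = 2 * r + a\<close>; for \<open>n < r\<close> both sides vanish.
\<close>

lemma q_vandermonde:
  assumes q: "norm q < 1" "q \<noteq> 0"
  shows "(\<Sum>\<^sub>\<infinity>j. q powi (j\<^sup>2 + a * j) * inv_qfac q (n - j) * (inv_qfac q (j - r) * inv_qfac q (j + a + r)))
       = q powi (r\<^sup>2 + a * r) * inv_qfac q (n - r) * inv_qfac q (n + a + r)" (is "?L = ?R")
proof -
  have "q powi ((k + r)\<^sup>2 + a * (k + r)) = q powi (r\<^sup>2 + a * r) * q powi (k\<^sup>2 + k * (2 * r + a))" for k
    using q(2) by (simp flip: power_int_add add: power2_eq_square algebra_simps)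
  then have "?L = q powi (r\<^sup>2 + a * r) * qconv q (\<lambda>k. q powi (k\<^sup>2 + k * (2*r+a)) * inv_qfac q (k + (2*r+a))) (n - r) 0"
    unfolding qconv_def infsum_cmult_right'[symmetric]
    by (subst infsum_shift_int[symmetric, where c = r]) (simp add: algebra_simps)
  also have "\<dots> = ?R"
  proof (cases "0 \<le> n - r")
    case True
    then show ?thesis
      using q_vandermonde_nat[OF q, of "2*r+a" "nat (n - r)"] by (simp add: algebra_simps)
  next
    case False
    have "inv_qfac q (n - r - k) = 0 \<or> inv_qfac q k = 0" for k
      using False by (cases "k < 0") auto
    then have "qconv q \<alpha> (n - r) 0 = 0" for \<alpha>
      unfolding qconv_def by (intro infsum_0) auto
    with False show ?thesis by simp
  qed
  finally show ?thesis .
qed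

text \<open>
  Expanding \<open>qconv q \<alpha> j (j + a)\<close> and summing over \<open>j\<close> first, the inner sum is \<open>q_vandermonde\<close>. The
  double sum has finite support, because a nonzero term needs \<open>r \<le> j \<le> n\<close> and \<open>0 \<le> j + a + r\<close>.
\<close>

lemma bailey_lemma:
  assumes q: "norm q < 1" "q \<noteq> 0"
  shows "(\<Sum>\<^sub>\<infinity>j. q powi (j\<^sup>2 + a * j) * inv_qfac q (n - j) * qconv q \<alpha> j (j + a))
       = qconv q (\<lambda>r. q powi (r\<^sup>2 + a * r) * \<alpha> r) n (n + a)"
proof -
  let ?f = "\<lambda>j r. \<alpha> r * (q powi (j\<^sup>2 + a * j) * inv_qfac q (n - j) * (inv_qfac q (j - r) * inv_qfac q (j + a + r)))"
  have "(\<lambda>(j, r). ?f j r) summable_on UNIV \<times> UNIV"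
  proof (rule finite_nonzero_values_imp_summable_on, rule finite_subset)
    show "{x \<in> UNIV \<times> UNIV. (\<lambda>(j, r). ?f j r) x \<noteq> 0} \<subseteq> {- \<bar>a\<bar>..n} \<times> {- n - a..n}"
    proof clarify
      fix j r assume "?f j r \<noteq> 0"
      then have "0 \<le> n - j" "0 \<le> j - r" "0 \<le> j + a + r"
        by (auto dest!: inv_qfac_nonzeroD)
      then show "j \<in> {- \<bar>a\<bar>..n} \<and> r \<in> {- n - a..n}" by auto
    qed
  qed simp
  then have "(\<Sum>\<^sub>\<infinity>j. \<Sum>\<^sub>\<infinity>r. ?f j r) = (\<Sum>\<^sub>\<infinity>r. \<Sum>\<^sub>\<infinity>j. ?f j r)"
    by (rule infsum_swap_banach)
  then show ?thesis
    unfolding infsum_cmult_right' q_vandermonde[OF q]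
    unfolding qconv_def infsum_cmult_right'[symmetric] by (simp add: mult_ac)
qed

section \<open>Jacobi's triple product\<close>

lemma summable_gaussian_nat:
  fixes x y :: real
  assumes "0 \<le> x" "x < 1" "0 \<le> y"
  shows "summable (\<lambda>n. x ^ n\<^sup>2 * y ^ n)"
proof -
  have "(\<lambda>n. y * (x * (x ^ n * x ^ n))) \<longlonglongrightarrow> y * (x * (0 * 0))"
    using assms by (intro tendsto_intros LIMSEQ_realpow_zero)
  then have "\<forall>\<^sub>F n in sequentially. y * (x * (x ^ n * x ^ n)) < 1/2"
    by (rule order_tendstoD) simp
  then obtain M where M: "\<And>n. n \<ge> M \<Longrightarrow> y * (x * (x ^ n * x ^ n)) < 1/2"
    by (auto simp: eventually_sequentially)
  show ?thesis
  proof (rule summable_ratio_test[of "1/2" M])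
    fix n assume "M \<le> n"
    have "x ^ (Suc n)\<^sup>2 * y ^ Suc n = (y * (x * (x ^ n * x ^ n))) * (x ^ n\<^sup>2 * y ^ n)"
      by (simp add: power2_eq_square power_add algebra_simps)
    also have "\<dots> \<le> 1/2 * (x ^ n\<^sup>2 * y ^ n)"
      using M[OF \<open>M \<le> n\<close>] assms by (intro mult_right_mono) auto
    finally show "norm (x ^ (Suc n)\<^sup>2 * y ^ Suc n) \<le> 1/2 * norm (x ^ n\<^sup>2 * y ^ n)"
      using assms by simp
  qed simp
qed

definition theta_term :: "complex \<Rightarrow> complex \<Rightarrow> int \<Rightarrow> complex" where
  "theta_term p z r = (-1) powi r * p powi r\<^sup>2 * z powi r"

lemma theta_term_0 [simp]: "theta_term p z 0 = 1"
  by (simp add: theta_term_def)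

lemma norm_minus_one_powi [simp]: "norm ((-1::complex) powi r) = 1"
  by (simp add: norm_power_int)

lemma theta_abs_summable:
  assumes "norm p < 1"
  shows "(\<lambda>r. norm (theta_term p z r)) summable_on UNIV"
proof (rule summable_on_int_nat_split)
  have powi_sq: "p powi (int n)\<^sup>2 = p ^ n\<^sup>2" for n
    by (metis of_nat_power power_int_of_nat)
  have *: "(\<lambda>n. norm p ^ n\<^sup>2 * y ^ n) summable_on UNIV" if "0 \<le> y" for y
    using summable_gaussian_nat[of "norm p" y] assms that
    by (subst summable_on_UNIV_nonneg_real_iff) auto
  show "(\<lambda>n. norm (theta_term p z (int n))) summable_on UNIV"
    using *[of "norm z"] by (simp add: theta_term_def norm_mult powi_sq norm_power)
  show "(\<lambda>n. norm (theta_term p z (- int n))) summable_on UNIV"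
    using *[of "inverse (norm z)"]
    by (simp add: theta_term_def norm_mult powi_sq norm_power power_int_minus norm_inverse power_inverse)
qed

text \<open>
  Shifting the index of a theta sequence by one multiplies it, up to a constant, by \<open>(p\<^sup>2) powi r\<close>.
  This is exactly the weight in the recurrences for \<open>qconv\<close> to the base \<open>p\<^sup>2\<close>, so that the shifted
  sequence can be eliminated from them.
\<close>

lemma theta_qconv_pred:
  assumes p: "norm p < 1" "p \<noteq> 0" and z: "z \<noteq> 0"
  shows "(1 - (p\<^sup>2) powi (a + b)) * qconv (p\<^sup>2) (theta_term p z) a b
       = (1 - z * p powi (2 * a - 1)) * qconv (p\<^sup>2) (theta_term p z) (a - 1) b"
proof -
  let ?Q = "p\<^sup>2" let ?\<alpha> = "theta_term p z"
  let ?\<gamma> = "\<lambda>r. ?Q powi (-r) * ?\<alpha> r"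
  have Q: "norm ?Q < 1" "?Q \<noteq> 0"
    using p by (simp_all add: norm_power power_less_one_iff)
  have Q_powi: "?Q powi k = p powi (2 * k)" for k
    by (simp add: power_int_power)
  have "?\<gamma> (r + 1) = (- z / p) * ?\<alpha> r" for r
  proof -
    have "p powi (- (2 * (r + 1))) * p powi (r + 1)\<^sup>2 = p powi (r\<^sup>2 - 1)"
      using p(2) by (simp flip: power_int_add add: power2_eq_square algebra_simps)
    also have "\<dots> = p powi r\<^sup>2 / p"
      using p(2) by (simp add: power_int_diff)
    finally have "?Q powi (- (r + 1)) * p powi (r + 1)\<^sup>2 = p powi r\<^sup>2 / p"
      by (simp add: Q_powi)
    moreover have "(-1) powi (r + 1) = - ((-1) powi r :: complex)" "z powi (r + 1) = z * z powi r"
      using z by (simp_all add: power_int_add)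
    ultimately show ?thesis
      by (simp only: theta_term_def mult_ac) (simp add: mult_ac)
  qed
  then have "qconv ?Q ?\<gamma> a (b - 1) = (- z / p) * qconv ?Q ?\<alpha> (a - 1) b"
    unfolding qconv_shift[symmetric] qconv_cmult[symmetric] by simp
  moreover have "qconv ?Q ?\<gamma> a (b - 1) = qconv ?Q ?\<gamma> a b - ?Q powi b * qconv ?Q ?\<alpha> a b"
  proof -
    have "?Q powi r * ?\<gamma> r = ?\<alpha> r" for r
      using Q(2) by (simp add: power_int_minus)
    then show ?thesis
      using qconv_pred_right[OF Q, of ?\<gamma> a b] by (simp only:)
  qed
  moreover have "qconv ?Q ?\<alpha> (a - 1) b = qconv ?Q ?\<alpha> a b - ?Q powi a * qconv ?Q ?\<gamma> a b"
    by (rule qconv_pred_left[OF Q])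
  moreover have "(1 - x * y) * V = (1 + x * w) * V'"
    if "G' = w * V'" "G' = G - y * V" "V' = V - x * G" for x y w V V' G G' :: complex
    using that by algebra
  ultimately have "(1 - ?Q powi a * ?Q powi b) * qconv ?Q ?\<alpha> a b
      = (1 + ?Q powi a * (- z / p)) * qconv ?Q ?\<alpha> (a - 1) b"
    by blast
  moreover have "p powi (2 * a - 1) = ?Q powi a / p" "?Q powi (a + b) = ?Q powi a * ?Q powi b"
    using p(2) by (simp_all add: Q_powi power_int_diff power_int_add distrib_left)
  ultimately show ?thesis
    by (simp add: mult.commute)
qed

lemma theta_qconv_left:
  assumes p: "norm p < 1" "p \<noteq> 0" and z: "z \<noteq> 0"
  shows "qpoch (p\<^sup>2) (p\<^sup>2) (m + n) * qconv (p\<^sup>2) (theta_term p z) (int m) (int n)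
       = qpoch (z * p) (p\<^sup>2) m * (qpoch (p\<^sup>2) (p\<^sup>2) n * qconv (p\<^sup>2) (theta_term p z) 0 (int n))"
proof (induction m)
  case (Suc m)
  let ?V = "\<lambda>m. qconv (p\<^sup>2) (theta_term p z) (int m) (int n)"
  have e: "int (Suc m) + int n = int (Suc (m + n))" "2 * int (Suc m) - 1 = int (2 * m + 1)"
     "int (Suc m) - 1 = int m"
    by auto
  have "(1 - (p\<^sup>2) ^ Suc (m + n)) * ?V (Suc m) = (1 - z * p ^ (2 * m + 1)) * ?V m"
    using theta_qconv_pred[OF p z, of "int (Suc m)" "int n"] unfolding e power_int_of_nat .
  then have "qpoch (p\<^sup>2) (p\<^sup>2) (Suc m + n) * ?V (Suc m)
      = (1 - z * p * (p\<^sup>2) ^ m) * (qpoch (p\<^sup>2) (p\<^sup>2) (m + n) * ?V m)"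
    by (simp add: qpoch_Suc power_mult mult_ac flip: power_mult)
  then show ?case
    unfolding Suc.IH by (simp add: qpoch_Suc mult_ac)
qed simp

text \<open>
  The finite triple product, a symmetric form of the q-binomial theorem. The factor with \<open>p / z\<close>
  comes from \<open>r \<mapsto> - r\<close>, which exchanges \<open>m\<close> with \<open>n\<close> and \<open>z\<close> with \<open>1 / z\<close>.
\<close>

lemma theta_qconv:
  assumes p: "norm p < 1" "p \<noteq> 0" and z: "z \<noteq> 0"
  shows "qpoch (p\<^sup>2) (p\<^sup>2) (m + n) * qconv (p\<^sup>2) (theta_term p z) (int m) (int n)
       = qpoch (z * p) (p\<^sup>2) m * qpoch (p / z) (p\<^sup>2) n"
proof -
  have "theta_term p z (0 - r) = theta_term p (1 / z) r" for r
    unfolding theta_term_def diff_0 power_int_minus_one_minus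
    by (simp add: power_int_minus power_int_inverse divide_inverse)
  then have "qconv (p\<^sup>2) (theta_term p (1 / z)) (int n) 0 = qconv (p\<^sup>2) (theta_term p z) 0 (int n)"
    using qconv_reflect[of "p\<^sup>2" "theta_term p z" 0 "int n" 0] by simp
  with theta_qconv_left[OF p, of "1 / z" n 0] z
  have "qpoch (p\<^sup>2) (p\<^sup>2) n * qconv (p\<^sup>2) (theta_term p z) 0 (int n) = qpoch (p / z) (p\<^sup>2) n"
    by simp
  with theta_qconv_left[OF p z, of m n] show ?thesis by simp
qed

lemma qconv_tendsto:
  assumes q: "norm q < 1" and \<alpha>: "(\<lambda>r. norm (\<alpha> r)) summable_on UNIV"
  shows "(\<lambda>N. qconv q \<alpha> (int N) (int N + a)) \<longlonglongrightarrow> infsum \<alpha> UNIV / (qpoch_inf q q)\<^sup>2"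
proof -
  obtain C where C: "0 < C" "\<And>n. norm (inv_qfac q n) \<le> C"
    using inv_qfac_bounded[OF q] by blast
  let ?c = "inverse (qpoch_inf q q)"
  have "(\<lambda>N. \<Sum>\<^sub>\<infinity>r. \<alpha> r * inv_qfac q (int N - r) * inv_qfac q (int N + a + r))
      \<longlonglongrightarrow> (\<Sum>\<^sub>\<infinity>r. \<alpha> r * ?c * ?c)"
  proof (rule tannery_infsum)
    show "norm (\<alpha> r * inv_qfac q (int N - r) * inv_qfac q (int N + a + r)) \<le> norm (\<alpha> r) * (C * C)" for N r
      unfolding norm_mult mult.assoc using C by (intro mult_left_mono mult_mono) (auto intro: less_imp_le)
    show "(\<lambda>r. norm (\<alpha> r) * (C * C)) summable_on UNIV"
      by (intro summable_on_cmult_left \<alpha>)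
    show "(\<lambda>N. \<alpha> r * inv_qfac q (int N - r) * inv_qfac q (int N + a + r)) \<longlonglongrightarrow> \<alpha> r * ?c * ?c" for r
      using inv_qfac_tendsto[OF q, of "-r"] inv_qfac_tendsto[OF q, of "a + r"]
      by (auto intro!: tendsto_mult simp: add.assoc)
  qed
  then show ?thesis
    by (simp add: qconv_def infsum_cmult_left' mult.assoc divide_inverse power2_eq_square)
qed

text \<open>
  The limit \<open>N \<longlonglongrightarrow> \<infinity>\<close> of the finite form with \<open>m = n = N\<close>: each reciprocal q-factorial in the
  convolution tends to \<open>1 / (p\<^sup>2;p\<^sup>2)\<^sub>\<infinity>\<close>, and the prefactor cancels one of the two.
\<close>

theorem jacobi_triple_product:
  assumes p: "norm p < 1" "p \<noteq> 0" and z: "z \<noteq> 0"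
  shows "(\<Sum>\<^sub>\<infinity>r. theta_term p z r)
       = qpoch_inf (p\<^sup>2) (p\<^sup>2) * qpoch_inf (z * p) (p\<^sup>2) * qpoch_inf (p / z) (p\<^sup>2)"
proof -
  let ?Q = "p\<^sup>2"
  have Q: "norm ?Q < 1"
    using p by (simp add: norm_power power_less_one_iff)
  have "strict_mono (\<lambda>N. N + N :: nat)"
    by (simp add: strict_mono_def)
  from LIMSEQ_subseq_LIMSEQ[OF qpoch_tendsto[OF Q] this]
  have "(\<lambda>N. qpoch ?Q ?Q (N + N)) \<longlonglongrightarrow> qpoch_inf ?Q ?Q"
    by (simp add: o_def)
  from tendsto_mult[OF this qconv_tendsto[OF Q theta_abs_summable[OF p(1), of z], of 0]]
  have "(\<lambda>N. qpoch (z * p) ?Q N * qpoch (p / z) ?Q N)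
      \<longlonglongrightarrow> qpoch_inf ?Q ?Q * ((\<Sum>\<^sub>\<infinity>r. theta_term p z r) / (qpoch_inf ?Q ?Q)\<^sup>2)"
    by (simp add: theta_qconv[OF p z])
  moreover have "(\<lambda>N. qpoch (z * p) ?Q N * qpoch (p / z) ?Q N)
      \<longlonglongrightarrow> qpoch_inf (z * p) ?Q * qpoch_inf (p / z) ?Q"
    by (intro tendsto_mult qpoch_tendsto Q)
  ultimately have "qpoch_inf ?Q ?Q * ((\<Sum>\<^sub>\<infinity>r. theta_term p z r) / (qpoch_inf ?Q ?Q)\<^sup>2)
      = qpoch_inf (z * p) ?Q * qpoch_inf (p / z) ?Q"
    by (rule LIMSEQ_unique)
  then show ?thesis
    using qpoch_inf_nonzero[OF Q] by (simp add: field_simps power2_eq_square)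
qed

section \<open>Bailey pairs of theta sequences\<close>

lemma theta_twist:
  assumes "q \<noteq> 0"
  shows "q powi r * theta_term q z r = theta_term q (q * z) r"
    and "q powi (- r) * theta_term q (q * z) r = theta_term q z r"
  using assms by (simp_all add: theta_term_def power_int_mult_distrib power_int_minus)

context
  fixes q :: complex
  assumes q: "norm q < 1" "q \<noteq> 0"
begin

text \<open>
  The reflection \<open>r \<mapsto> - 1 - r\<close> fixes \<open>r\<^sup>2 + r\<close> and the product of the two reciprocal q-factorials,
  but changes the sign \<open>(-1)\<^sup>r\<close>.
\<close>

lemma theta_pair_antisym: "qconv q (theta_term q q) n (n + 1) = 0"
proof -
  have "theta_term q q (-1 - r) = (-1) * theta_term q q r" for r
  proof -
    have e: "(-1 - r)\<^sup>2 + (-1 - r) = r\<^sup>2 + r"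
      by (simp add: power2_eq_square algebra_simps)
    have "q powi (-1 - r)\<^sup>2 * q powi (-1 - r) = q powi r\<^sup>2 * q powi r"
      using q(2) by (simp only: power_int_add[symmetric] e simp_thms)
    moreover have "(-1) powi (-1 - r) = - ((-1) powi r :: complex)"
      using power_int_minus_one_minus[of "1 + r", where 'a = complex] by (simp add: power_int_add)
    ultimately show ?thesis by (simp add: theta_term_def)
  qed
  then have "qconv q (theta_term q q) n (n + 1) = (-1) * qconv q (theta_term q q) n (n + 1)"
    using qconv_reflect[of q "theta_term q q" "-1" n "n + 1"] unfolding qconv_cmult[symmetric] by simp
  then show ?thesis by simp
qed

text \<open>
  Lowering the second argument of the left-hand side produces the right-hand side and a correction
  term that vanishes by antisymmetry.
\<close>

lemma theta_pair_odd: "qconv q (theta_term q 1) n (n + 1) = qconv q (theta_term q 1) n n"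
  using qconv_pred_right[OF q, of "theta_term q 1" n "n + 1"] theta_pair_antisym[of n]
  by (simp add: theta_twist[OF q(2)])

lemma theta_pair_linear: "qconv q (theta_term q q) n n = q powi n * qconv q (theta_term q 1) n n"
  using qconv_pred_left[OF q, of "theta_term q q" n n] theta_pair_antisym[of "n - 1"]
    theta_twist(2)[OF q(2), of _ 1] by simp

text \<open>
  Lowering both arguments, using \<open>theta_pair_odd\<close> and \<open>theta_pair_linear\<close>, multiplies the sum by
  \<open>1 - q\<^bsup>2n\<^esup>\<close>, which is the recurrence of \<open>1 / (q\<^sup>2;q\<^sup>2)\<^sub>n\<close>. This is Gauss's evaluation of the
  alternating sum of q-binomial coefficients, with \<open>q\<close> replaced by \<open>1 / q\<close>.
\<close>

lemma theta_pair_even: "qconv q (theta_term q 1) n n = inv_qfac (q\<^sup>2) n"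
proof (cases "n < 0")
  case True
  have "inv_qfac q (n - r) = 0 \<or> inv_qfac q (n + r) = 0" for r
    using True by (cases "r < 0") auto
  then have "qconv q \<alpha> n n = 0" for \<alpha>
    unfolding qconv_def by (intro infsum_0) auto
  with True show ?thesis by simp
next
  case False
  let ?\<alpha> = "theta_term q 1"
  have q2: "norm (q\<^sup>2) < 1"
    using q by (simp add: norm_power power_less_one_iff)
  have step: "qconv q ?\<alpha> (n - 1) (n - 1) = (1 - (q\<^sup>2) powi n) * qconv q ?\<alpha> n n" for n
  proof -
    have "?\<alpha> (0 - r) = ?\<alpha> r" for r
      unfolding theta_term_def diff_0 power_int_minus_one_minus by simp
    then have "qconv q ?\<alpha> n (n - 1) = qconv q ?\<alpha> (n - 1) n"
      using qconv_reflect[of q ?\<alpha> 0 n "n - 1"] by simp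
    also have "\<dots> = qconv q ?\<alpha> (n - 1) (n - 1)"
      using theta_pair_odd[of "n - 1"] by simp
    finally have "qconv q ?\<alpha> (n - 1) (n - 1)
        = qconv q ?\<alpha> n n - q powi n * (q powi n * qconv q ?\<alpha> n n)"
      using qconv_pred_right[OF q, of ?\<alpha> n n] theta_pair_linear[of n]
      by (simp add: theta_twist[OF q(2)])
    moreover have "(q\<^sup>2) powi n = q powi n * q powi n"
      by (simp add: power2_eq_square power_int_mult_distrib)
    ultimately show ?thesis
      by (simp add: algebra_simps)
  qed
  have "qconv q ?\<alpha> (int m) (int m) = inv_qfac (q\<^sup>2) (int m)" for m
  proof (induction m)
    case (Suc m)
    have "(1 - (q\<^sup>2) powi int (Suc m)) * qconv q ?\<alpha> (int (Suc m)) (int (Suc m))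
        = (1 - (q\<^sup>2) powi int (Suc m)) * inv_qfac (q\<^sup>2) (int (Suc m))"
      using step[of "int (Suc m)"] inv_qfac_pred[OF q2, of "int (Suc m)"] Suc.IH by simp
    then show ?case
      using one_minus_power_nonzero[OF q2, of "Suc m"]
      unfolding power_int_of_nat by simp
  qed simp
  from this[of "nat n"] False show ?thesis by simp
qed

end

section \<open>Double sums from Bailey pairs\<close>

text \<open>
  Two applications of Bailey's lemma give an identity at each finite level \<open>N\<close>, in which the double
  sum carries an extra factor \<open>1 / (q;q)\<^sub>N\<^sub>-\<^sub>n\<close> and the single sum is a \<open>qconv\<close>. As \<open>N\<close> grows the former
  factor tends to \<open>1 / (q;q)\<^sub>\<infinity>\<close> and the two in the latter to \<open>1 / (q;q)\<^sub>\<infinity>\<^sup>2\<close>.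
\<close>

lemma bailey_double_sum:
  fixes t :: "int \<Rightarrow> int \<Rightarrow> complex"
  assumes q: "norm q < 1" "q \<noteq> 0"
    and pair: "\<And>n. qconv q \<alpha> n (n + a) = \<beta> n"
    and t: "\<And>n j. t n j = q powi (n\<^sup>2 + a * n) * q powi (j\<^sup>2 + a * j) * inv_qfac q (n - j) * \<beta> j"
    and t_summable: "(\<lambda>(n, j). norm (t n j)) summable_on UNIV"
    and \<alpha>_summable: "(\<lambda>r. norm (q powi (r\<^sup>2 + a * r) * (q powi (r\<^sup>2 + a * r) * \<alpha> r))) summable_on UNIV"
  shows "(\<Sum>\<^sub>\<infinity>(n, j). t n j)
    = (\<Sum>\<^sub>\<infinity>r. q powi (r\<^sup>2 + a * r) * (q powi (r\<^sup>2 + a * r) * \<alpha> r)) / qpoch_inf q q"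
proof -
  define w where "w = (\<lambda>r. q powi (r\<^sup>2 + a * r))"
  let ?c = "inverse (qpoch_inf q q)"
  obtain C where C: "0 < C" "\<And>n. norm (inv_qfac q n) \<le> C"
    using inv_qfac_bounded[OF q(1)] by blast
  have bound: "norm (t n j * inv_qfac q m) \<le> norm (t n j) * C" for n j m
    unfolding norm_mult using C by (intro mult_left_mono) auto
  have dominated: "(\<lambda>x. (\<lambda>(n, j). norm (t n j)) x * C) summable_on UNIV"
    by (rule summable_on_cmult_left[OF t_summable])
  have finite_form: "qconv q (\<lambda>r. w r * (w r * \<alpha> r)) N (N + a)
      = (\<Sum>\<^sub>\<infinity>(n, j). t n j * inv_qfac q (N - n))" for N
  proof -
    have "(\<lambda>(n, j). t n j * inv_qfac q (N - n)) summable_on UNIV"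
    proof (rule abs_summable_summable, rule summable_on_comparison_test[OF dominated])
      show "norm ((\<lambda>(n, j). t n j * inv_qfac q (N - n)) x) \<le> (\<lambda>(n, j). norm (t n j)) x * C" for x
        by (simp only: split_beta bound)
    qed simp
    then have "(\<Sum>\<^sub>\<infinity>(n, j). t n j * inv_qfac q (N - n)) = (\<Sum>\<^sub>\<infinity>n. \<Sum>\<^sub>\<infinity>j. t n j * inv_qfac q (N - n))"
      using infsum_Sigma'_banach[of "\<lambda>n j. t n j * inv_qfac q (N - n)" UNIV "\<lambda>_. UNIV"] by simp
    also have "\<dots> = (\<Sum>\<^sub>\<infinity>n. w n * inv_qfac q (N - n) * qconv q (\<lambda>r. w r * \<alpha> r) n (n + a))"
    proof (rule infsum_cong)
      fix n :: int
      have "(\<Sum>\<^sub>\<infinity>j. t n j * inv_qfac q (N - n))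
          = (\<Sum>\<^sub>\<infinity>j. w n * inv_qfac q (N - n) * (w j * inv_qfac q (n - j) * \<beta> j))"
        by (intro infsum_cong) (simp add: t w_def)
      also have "\<dots> = w n * inv_qfac q (N - n) * (\<Sum>\<^sub>\<infinity>j. w j * inv_qfac q (n - j) * qconv q \<alpha> j (j + a))"
        unfolding pair by (rule infsum_cmult_right')
      also have "(\<Sum>\<^sub>\<infinity>j. w j * inv_qfac q (n - j) * qconv q \<alpha> j (j + a))
          = qconv q (\<lambda>r. w r * \<alpha> r) n (n + a)"
        unfolding w_def by (rule bailey_lemma[OF q])
      finally show "(\<Sum>\<^sub>\<infinity>j. t n j * inv_qfac q (N - n))
          = w n * inv_qfac q (N - n) * qconv q (\<lambda>r. w r * \<alpha> r) n (n + a)" .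
    qed
    also have "\<dots> = qconv q (\<lambda>r. w r * (w r * \<alpha> r)) N (N + a)"
      unfolding w_def by (rule bailey_lemma[OF q])
    finally show ?thesis ..
  qed
  have "(\<lambda>N. \<Sum>\<^sub>\<infinity>x. (\<lambda>(n, j). t n j * inv_qfac q (int N - n)) x)
      \<longlonglongrightarrow> (\<Sum>\<^sub>\<infinity>x. (\<lambda>(n, j). t n j) x * ?c)"
  proof (rule tannery_infsum[OF _ dominated])
    show "norm ((\<lambda>(n, j). t n j * inv_qfac q (int N - n)) x) \<le> (\<lambda>(n, j). norm (t n j)) x * C" for N x
      by (simp only: split_beta bound)
    show "(\<lambda>N. (\<lambda>(n, j). t n j * inv_qfac q (int N - n)) x) \<longlonglongrightarrow> (\<lambda>(n, j). t n j) x * ?c" for x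
      using inv_qfac_tendsto[OF q(1), of "- fst x"]
      by (cases x) (auto intro!: tendsto_mult)
  qed
  then have "(\<lambda>N. qconv q (\<lambda>r. w r * (w r * \<alpha> r)) (int N) (int N + a)) \<longlonglongrightarrow> (\<Sum>\<^sub>\<infinity>(n, j). t n j) * ?c"
    unfolding finite_form infsum_cmult_left' .
  moreover have "(\<lambda>N. qconv q (\<lambda>r. w r * (w r * \<alpha> r)) (int N) (int N + a))
      \<longlonglongrightarrow> (\<Sum>\<^sub>\<infinity>r. w r * (w r * \<alpha> r)) / (qpoch_inf q q)\<^sup>2"
    by (rule qconv_tendsto[OF q(1)]) (use \<alpha>_summable in \<open>simp add: w_def\<close>)
  ultimately have "(\<Sum>\<^sub>\<infinity>(n, j). t n j) * ?c = (\<Sum>\<^sub>\<infinity>r. w r * (w r * \<alpha> r)) / (qpoch_inf q q)\<^sup>2"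
    by (rule LIMSEQ_unique)
  then show ?thesis
    using qpoch_inf_nonzero[OF q(1)] unfolding w_def
    by (simp only: power2_eq_square divide_inverse inverse_mult_distrib mult.assoc[of _ ?c ?c, symmetric]
          mult_right_cancel inverse_nonzero_iff_nonzero simp_thms)
qed

lemma summable_geometric_pair:
  fixes x :: real
  assumes "0 \<le> x" "x < 1"
  shows "(\<lambda>(i, j). x ^ i * x ^ j) summable_on (UNIV :: (nat \<times> nat) set)"
proof -
  have "summable (\<lambda>n. x ^ n)"
    using assms by (intro summable_geometric) auto
  then have geometric: "(\<lambda>n. x ^ n) summable_on UNIV"
    using assms by (subst summable_on_UNIV_nonneg_real_iff) auto
  have "(\<lambda>(i, j). x ^ i * x ^ j) summable_on Sigma (UNIV :: nat set) (\<lambda>_. UNIV :: nat set)"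
  proof (rule summable_on_SigmaI)
    show "((\<lambda>j. (\<lambda>(i, j). x ^ i * x ^ j) (i, j)) has_sum x ^ i * infsum (\<lambda>j. x ^ j) UNIV) UNIV" for i
      unfolding split by (intro has_sum_cmult_right has_sum_infsum geometric)
    show "(\<lambda>i. x ^ i * infsum (\<lambda>j. x ^ j) UNIV) summable_on UNIV"
      by (intro summable_on_cmult_left geometric)
  qed (use assms in auto)
  then show ?thesis by simp
qed

text \<open>
  The terms of the integer-indexed double sum vanish off the image of \<open>(i, j) \<mapsto> (i + j, j)\<close>. The
  parameter \<open>c\<close> allows for a linear factor in the Bailey pair, and \<open>a\<close> for its shift.
\<close>

lemma double_sum_eq_theta:
  fixes a c :: nat
  assumes q: "norm q < 1" "q \<noteq> 0"
    and pair: "\<And>n. qconv q (theta_term q z) n (n + int a) = q powi (int c * n) * inv_qfac (q\<^sup>2) n"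
  shows "((\<lambda>(i::nat, j::nat). q ^ (i\<^sup>2 + 2*i*j + 2*j\<^sup>2 + a * i + 2*a*j + c * j) / (qpoch q q i * qpoch (q\<^sup>2) (q\<^sup>2) j))
     has_sum (\<Sum>\<^sub>\<infinity>r. theta_term (q ^ 3) (z * q ^ (2 * a)) r) / qpoch_inf q q) UNIV"
proof -
  define \<beta> where "\<beta> = (\<lambda>n. q powi (int c * n) * inv_qfac (q\<^sup>2) n)"
  define t where "t = (\<lambda>n j. q powi (n\<^sup>2 + int a * n) * q powi (j\<^sup>2 + int a * j) * inv_qfac q (n - j) * \<beta> j)"
  define h where "h = (\<lambda>(i, j). (int i + int j, int j))"
  let ?T = "\<lambda>(i::nat, j::nat). q ^ (i\<^sup>2 + 2*i*j + 2*j\<^sup>2 + a * i + 2*a*j + c * j) / (qpoch q q i * qpoch (q\<^sup>2) (q\<^sup>2) j)"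
  have q2: "norm (q\<^sup>2) < 1"
    using q by (simp add: norm_power power_less_one_iff)
  have q3: "norm (q ^ 3) < 1"
    using q by (simp add: norm_power power_less_one_iff)
  have inj: "inj h"
    by (auto simp: inj_def h_def)
  have outside: "(\<lambda>(n, j). t n j) x = 0" if "x \<notin> range h" for x
  proof (rule ccontr)
    obtain n j where x: "x = (n, j)" by (cases x)
    assume "(\<lambda>(n, j). t n j) x \<noteq> 0"
    then have "0 \<le> n - j" "0 \<le> j"
      by (auto simp: x t_def \<beta>_def dest!: inv_qfac_nonzeroD)
    then have "x = h (nat (n - j), nat j)"
      by (simp add: x h_def)
    with that show False by blast
  qed
  have inside: "(\<lambda>(n, j). t n j) (h x) = ?T x" for x
  proof -
    obtain i j where x: "x = (i, j)" by (cases x)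
    have "(int i + int j)\<^sup>2 + int a * (int i + int j) + ((int j)\<^sup>2 + int a * int j) + int c * int j
        = int (i\<^sup>2 + 2*i*j + 2*j\<^sup>2 + a * i + 2*a*j + c * j)"
      by (simp add: power2_eq_square algebra_simps)
    then have "q powi ((int i + int j)\<^sup>2 + int a * (int i + int j)) * q powi ((int j)\<^sup>2 + int a * int j)
          * q powi (int c * int j) = q powi int (i\<^sup>2 + 2*i*j + 2*j\<^sup>2 + a * i + 2*a*j + c * j)"
      using q(2) by (simp only: power_int_add[symmetric] simp_thms)
    then have "q powi ((int i + int j)\<^sup>2 + int a * (int i + int j)) * q powi ((int j)\<^sup>2 + int a * int j)
          * q powi (int c * int j) = q ^ (i\<^sup>2 + 2*i*j + 2*j\<^sup>2 + a * i + 2*a*j + c * j)"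
      unfolding power_int_of_nat .
    then show ?thesis
      by (simp add: x h_def t_def \<beta>_def inv_qfac_of_nat divide_inverse mult_ac)
  qed
  obtain C where C: "0 < C" "\<And>n. norm (inv_qfac q n) \<le> C"
    using inv_qfac_bounded[OF q(1)] by blast
  obtain D where D: "0 < D" "\<And>n. norm (inv_qfac (q\<^sup>2) n) \<le> D"
    using inv_qfac_bounded[OF q2] by blast
  \<comment> \<open>The quadratic exponent is at least \<open>i + j\<close>, so a product of geometric series dominates.\<close>
  have T_bound: "norm (?T x) \<le> (\<lambda>(i, j). norm q ^ i * norm q ^ j) x * (C * D)" for x
  proof -
    obtain i j where x: "x = (i, j)" by (cases x)
    let ?e = "i\<^sup>2 + 2*i*j + 2*j\<^sup>2 + a * i + 2*a*j + c * j"
    have "i \<le> i\<^sup>2" "j \<le> j\<^sup>2"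
      by (simp_all add: power2_eq_square)
    then have "norm q ^ ?e \<le> norm q ^ (i + j)"
      using q(1) by (intro power_decreasing) auto
    moreover have "norm (?T x) = norm q ^ ?e * (norm (inv_qfac q (int i)) * norm (inv_qfac (q\<^sup>2) (int j)))"
      by (simp add: x inv_qfac_of_nat norm_mult norm_divide norm_inverse norm_power divide_inverse)
    ultimately have "norm (?T x) \<le> norm q ^ (i + j) * (C * D)"
      using C D by (simp only:) (intro mult_mono; simp add: less_imp_le)
    then show ?thesis
      by (simp add: x power_add)
  qed
  have T_summable: "(\<lambda>x. norm (?T x)) summable_on UNIV"
    by (rule summable_on_comparison_test[OF summable_on_cmult_left[OF summable_geometric_pair[of "norm q"]] T_bound])
      (use q(1) in auto)
  have t_norm: "(\<lambda>x. norm ((\<lambda>(n, j). t n j) x)) summable_on UNIV"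
    using T_summable has_sum_via_injection[OF inj, of "\<lambda>x. norm ((\<lambda>(n, j). t n j) x)"] outside inside
    unfolding summable_on_def by simp
  then have t_summable: "(\<lambda>(n, j). norm (t n j)) summable_on UNIV"
    by (simp add: case_prod_unfold)
  \<comment> \<open>Two weights turn base \<open>q\<close> into \<open>q ^ 3\<close> and contribute \<open>q ^ (2 * a)\<close> to \<open>z\<close>.\<close>
  have twist: "q powi (r\<^sup>2 + int a * r) * (q powi (r\<^sup>2 + int a * r) * theta_term q z r)
      = theta_term (q ^ 3) (z * q ^ (2 * a)) r" for r
  proof -
    have "(q ^ 3) powi r\<^sup>2 = q powi r\<^sup>2 * q powi r\<^sup>2 * q powi r\<^sup>2"
      by (simp only: power3_eq_cube power_int_mult_distrib)
    moreover have "(q ^ (2 * a)) powi r = q powi (int a * r) * q powi (int a * r)"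
    proof -
      have "int (2 * a) * r = int a * r + int a * r" by simp
      then show ?thesis
        using q(2) by (simp only: power_int_power power_int_add simp_thms)
    qed
    moreover have "q powi (r\<^sup>2 + int a * r) = q powi r\<^sup>2 * q powi (int a * r)"
      using q(2) by (simp add: power_int_add)
    ultimately show ?thesis
      unfolding theta_term_def power_int_mult_distrib by (simp only: mult_ac)
  qed
  have "(\<Sum>\<^sub>\<infinity>(n, j). t n j) = (\<Sum>\<^sub>\<infinity>r. theta_term (q ^ 3) (z * q ^ (2 * a)) r) / qpoch_inf q q"
    using bailey_double_sum[OF q, of "theta_term q z" "int a" \<beta> t] pair t_summable
      theta_abs_summable[OF q3] by (simp add: twist \<beta>_def t_def)
  moreover have "(\<lambda>(n, j). t n j) summable_on UNIV"
    by (rule abs_summable_summable[OF t_norm])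
  ultimately have "((\<lambda>(n, j). t n j) has_sum
      (\<Sum>\<^sub>\<infinity>r. theta_term (q ^ 3) (z * q ^ (2 * a)) r) / qpoch_inf q q) UNIV"
    using has_sum_infsum by fastforce
  then have "((\<lambda>x. (\<lambda>(n, j). t n j) (h x)) has_sum
      (\<Sum>\<^sub>\<infinity>r. theta_term (q ^ 3) (z * q ^ (2 * a)) r) / qpoch_inf q q) UNIV"
    using has_sum_via_injection[OF inj, of "\<lambda>(n, j). t n j"] outside by blast
  then show ?thesis
    by (simp only: inside)
qed

section \<open>The three identities\<close>

lemma qpoch_inf_dissect_2:
  assumes "norm p < 1"
  shows "qpoch_inf a p = qpoch_inf a (p\<^sup>2) * qpoch_inf (a * p) (p\<^sup>2)"
  using qpoch_inf_dissect[OF assms, of 2 a] by (simp add: numeral_eq_Suc)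

lemma qpoch_inf_dissect_3:
  assumes "norm p < 1"
  shows "qpoch_inf a p = qpoch_inf a (p ^ 3) * qpoch_inf (a * p) (p ^ 3) * qpoch_inf (a * p\<^sup>2) (p ^ 3)"
  using qpoch_inf_dissect[OF assms, of 3 a] by (simp add: numeral_eq_Suc)

lemma double_sums_at_zero:
  fixes e :: "nat \<Rightarrow> nat \<Rightarrow> nat"
  assumes "\<And>i j. e i j = 0 \<longleftrightarrow> i = 0 \<and> j = 0"
  shows "((\<lambda>(i, j). (0::complex) ^ e i j / (qpoch 0 0 i * qpoch 0 0 j)) has_sum 1) UNIV"
proof -
  have "((\<lambda>(i, j). (0::complex) ^ e i j / (qpoch 0 0 i * qpoch 0 0 j)) has_sum 1) {(0, 0)}"
    using assms[of 0 0] by (intro has_sum_finiteI) simp_all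
  then show ?thesis
    by (rule has_sum_cong_neutral[THEN iffD1, rotated -1]) (use assms in auto)
qed

lemma qpoch_inf_zero [simp]: "qpoch_inf 0 p = 1"
  by (simp add: qpoch_inf_def)

theorem theorem1p1:
  fixes q :: complex
  assumes "norm q < 1"
  shows "((\<lambda>(i::nat, j::nat). q ^ (i^2 + 2*i*j + 2*j^2) / (qpoch q q i * qpoch (q^2) (q^2) j))
            has_sum ((qpoch_inf (q^3) (q^3))^2 / (qpoch_inf q q * qpoch_inf (q^6) (q^6)))) UNIV \<and>
         ((\<lambda>(i::nat, j::nat). q ^ (i^2 + 2*i*j + 2*j^2 + i + 2*j) / (qpoch q q i * qpoch (q^2) (q^2) j))
            has_sum ((qpoch_inf (q^6) (q^6))^2 / (qpoch_inf (q^2) (q^2) * qpoch_inf (q^3) (q^3)))) UNIV \<and>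
         ((\<lambda>(i::nat, j::nat). q ^ (i^2 + 2*i*j + 2*j^2 + j) / (qpoch q q i * qpoch (q^2) (q^2) j))
            has_sum (qpoch_inf (-q) q)) UNIV"
proof (cases "q = 0")
  case True
  then show ?thesis
    by (simp, intro conjI double_sums_at_zero) auto
next
  case False
  note q = assms False
  have small: "norm (q ^ k) < 1" if "0 < k" for k
    using q that by (simp add: norm_power power_less_one_iff)
  have nz: "qpoch_inf (q ^ k) (q ^ k) \<noteq> 0" if "0 < k" for k
    by (rule qpoch_inf_nonzero[OF small[OF that]])
  note nz1 = nz[of 1, simplified]
  \<comment> \<open>The triple product with base \<open>(q ^ 3)\<^sup>2 = q ^ 6\<close>.\<close>
  have theta: "(\<Sum>\<^sub>\<infinity>r. theta_term (q ^ 3) (q ^ c) r)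
      = qpoch_inf (q ^ 6) (q ^ 6) * qpoch_inf (q ^ (3 + c)) (q ^ 6) * qpoch_inf (q ^ (3 - c)) (q ^ 6)"
    if "c \<le> 3" for c
  proof -
    have "(q ^ 3)\<^sup>2 = q ^ 6" "q ^ c * q ^ 3 = q ^ (3 + c)" "q ^ 3 / q ^ c = q ^ (3 - c)"
      using q(2) that by (simp_all add: power_diff power_add flip: power_mult)
    then show ?thesis
      using jacobi_triple_product[OF small[of 3], of "q ^ c"] q(2) by simp
  qed
  \<comment> \<open>The products to the base \<open>q ^ 6\<close> into which both sides decompose.\<close>
  have cubic: "qpoch_inf (q ^ 3) (q ^ 3) = qpoch_inf (q ^ 3) (q ^ 6) * qpoch_inf (q ^ 6) (q ^ 6)"
    using qpoch_inf_dissect_2[OF small[of 3], of "q ^ 3"] by (simp flip: power_mult power_add)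
  have even: "qpoch_inf (q\<^sup>2) (q\<^sup>2)
      = qpoch_inf (q\<^sup>2) (q ^ 6) * qpoch_inf (q ^ 4) (q ^ 6) * qpoch_inf (q ^ 6) (q ^ 6)"
    using qpoch_inf_dissect_3[OF small[of 2], of "q\<^sup>2"] by (simp flip: power_mult power_add)
  have odd: "qpoch_inf q (q\<^sup>2)
      = qpoch_inf q (q ^ 6) * qpoch_inf (q ^ 3) (q ^ 6) * qpoch_inf (q ^ 5) (q ^ 6)"
    using qpoch_inf_dissect_3[OF small[of 2], of q] by (simp flip: power_mult power_add power_Suc)
  have full: "qpoch_inf q q = qpoch_inf q (q\<^sup>2) * qpoch_inf (q\<^sup>2) (q\<^sup>2)"
    using qpoch_inf_dissect_2[OF q(1), of q] by (simp add: power2_eq_square)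

  have "qpoch_inf (q ^ 6) (q ^ 6) * qpoch_inf (q ^ 3) (q ^ 6) * qpoch_inf (q ^ 3) (q ^ 6) / qpoch_inf q q
      = (qpoch_inf (q ^ 3) (q ^ 3))\<^sup>2 / (qpoch_inf q q * qpoch_inf (q ^ 6) (q ^ 6))"
    unfolding cubic using nz[of 6] by (simp add: power2_eq_square)
  with double_sum_eq_theta[OF q, of 1 0 0] theta[of 0] theta_pair_even[OF q]
  have first: "((\<lambda>(i::nat, j::nat). q ^ (i^2 + 2*i*j + 2*j^2) / (qpoch q q i * qpoch (q^2) (q^2) j))
            has_sum ((qpoch_inf (q^3) (q^3))^2 / (qpoch_inf q q * qpoch_inf (q^6) (q^6)))) UNIV"
    by simp

  have "qpoch_inf (q ^ 6) (q ^ 6) * qpoch_inf (q ^ 5) (q ^ 6) * qpoch_inf q (q ^ 6) / qpoch_inf q q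
      = (qpoch_inf (q ^ 6) (q ^ 6))\<^sup>2 / (qpoch_inf (q\<^sup>2) (q\<^sup>2) * qpoch_inf (q ^ 3) (q ^ 3))"
    using nz1 nz[of 6] unfolding full odd cubic by (simp add: power2_eq_square)
  with double_sum_eq_theta[OF q, of 1 1 0] theta[of 2] theta_pair_odd[OF q] theta_pair_even[OF q]
  have second: "((\<lambda>(i::nat, j::nat). q ^ (i^2 + 2*i*j + 2*j^2 + i + 2*j) / (qpoch q q i * qpoch (q^2) (q^2) j))
            has_sum ((qpoch_inf (q^6) (q^6))^2 / (qpoch_inf (q^2) (q^2) * qpoch_inf (q^3) (q^3)))) UNIV"
    by simp

  have "qpoch_inf (q ^ 6) (q ^ 6) * qpoch_inf (q ^ 4) (q ^ 6) * qpoch_inf (q\<^sup>2) (q ^ 6) / qpoch_inf q q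
      = qpoch_inf (- q) q"
  proof -
    have "qpoch_inf (q ^ 6) (q ^ 6) * qpoch_inf (q ^ 4) (q ^ 6) * qpoch_inf (q\<^sup>2) (q ^ 6)
        = qpoch_inf q q * qpoch_inf (- q) q"
      unfolding qpoch_inf_square[OF q(1), symmetric] even by (simp only: mult_ac)
    then show ?thesis using nz1 by simp
  qed
  with double_sum_eq_theta[OF q, of q 0 1] theta[of 1] theta_pair_linear[OF q] theta_pair_even[OF q]
  have third: "((\<lambda>(i::nat, j::nat). q ^ (i^2 + 2*i*j + 2*j^2 + j) / (qpoch q q i * qpoch (q^2) (q^2) j))
            has_sum (qpoch_inf (-q) q)) UNIV"
    by simp

  from first second third show ?thesis by blast
qed

end
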